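(* Let $\mathcal{Q}$ be a node query expressed by a key-invariant LocalSum GNN whose combination functions are ReLU feedforward networks. Then $\mathcal{Q}$ is definable in order-invariant first-order logic with counting, i.e. $\mathcal{Q}\in\mathrm{OrdInvFO{+}C}$.
   Context: Fix a finite set $\Pi=\{p_1,\dots,p_n\}$ of propositions. A graph is $G=(V,E,\mathrm{lab})$ with $V$ finite, $E\subseteq V\times V$ irreflexive and symmetric, $\mathrm{lab}:V\to\{0,1\}^n$; a pointed graph $G^u$ has distinguished node $u$; a node query is an isomorphism-closed class of pointed graphs. A keyed extension adds an injective $\mathrm{key}:V\to\mathbb{R}$. A GNN is a sequence of layers $(\mathrm{agg}_i,\mathrm{com}_i)_{i=1}^\ell$, $\mathrm{com}_i:\mathbb{R}^{2D_i}\to\mathbb{R}^{D_{i+1}}$, $D_1=n+1$, $D_{\ell+1}=1$; on a keyed graph the initial embedding is $\mathrm{lab}(v)\oplus(\mathrm{key}(v))$, each layer computes $\mathrm{emb}'(u)=\mathrm{com}_i(\mathrm{emb}(u),\mathrm{agg}_i(\{\!\{\mathrm{emb}(v)\mid(u,v)\in E\}\!\}))$, output is the final value at the distinguished node. LocalSum: each $\mathrm{agg}_i$ is coordinate-wise sum. A ReLU feedforward network is a composition of affine maps with rational coefficients and coordinate-wise $\mathrm{ReLU}(x)=\max(x,0)$. Accept iff output $>0$; key-invariant if for every pointed graph all or none of its keyed extensions are accepted; then it expresses the query of pointed graphs whose keyed extensions are accepted. First-order logic with counting (FO+C) over a structure (here a graph, possibly with a linear order $<$ and unary predicates $p\in\Pi$)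 is two-sorted: node variables range over $V$, number variables over $\mathbb{N}$. Terms: number variables, constants $0,1,\mathrm{ord}$ (interpreted as $|V|$), sums and products of terms, and counting terms $\#(x_1,\dots,x_k,y_1<\theta_1,\dots,y_\ell<\theta_\ell).\psi$, whose value is the number of tuples $(v_1,\dots,v_k,i_1,\dots,i_\ell)\in V^k\times\mathbb{N}^\ell$ with each $i_j$ less than the value of $\theta_j$ such that $\psi$ holds. Formulas: first-order formulas over the graph vocabulary using node variables, plus atomic formulas $\theta\le\eta$ between terms. A formula $\phi(x)$ with one free node variable and no free number variables over vocabulary $\{E,<\}\cup\Pi$ is order-invariant if for every pointed graph $G^u$ and all linear orders $<,<'$ on $V(G)$, $(G,<)\models\phi(u)$ iff $(G,<')\models\phi(u)$; it then defines a node query. $\mathrm{OrdInvFO{+}C}$ is the class of node queries so defined. *)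

theory Defs
  imports Complex_Main "HOL-Library.Multiset" "HOL-Library.Infinite_Typeclass"
    "Jordan_Normal_Form.Matrix"
begin

text \<open>Throughout, \<open>n\<close> is the number of propositions; the proposition \<open>p\<^sub>i\<^sub>+\<^sub>1\<close> is represented by the
  index \<open>i < n\<close>, and \<open>{0,1}\<^sup>n\<close> by the Boolean vectors of dimension \<open>n\<close>. Nodes are taken from
  a type \<open>'v\<close>. If \<open>'v\<close> is infinite, every finite graph has an isomorphic copy with nodes in \<open>'v\<close>, so
  that an isomorphism-closed class of pointed graphs is determined by its members over \<open>'v\<close>.\<close>

record 'v graph =
  nodes :: "'v set"
  edges :: "('v \<times> 'v) set"
  lab :: "'v \<Rightarrow> bool vec"

definition is_graph :: "nat \<Rightarrow> 'v graph \<Rightarrow> bool" where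
  "is_graph n G \<longleftrightarrow> finite (nodes G) \<and> edges G \<subseteq> nodes G \<times> nodes G \<and>
     irrefl (edges G) \<and> sym (edges G) \<and> (\<forall>v\<in>nodes G. lab G v \<in> carrier_vec n)"

type_synonym 'v pgraph = "'v graph \<times> 'v"

definition pointed_graphs :: "nat \<Rightarrow> 'v pgraph set" where
  "pointed_graphs n = {(G, u). is_graph n G \<and> u \<in> nodes G}"

definition pgraph_iso :: "'v pgraph \<Rightarrow> 'v pgraph \<Rightarrow> bool" where
  "pgraph_iso = (\<lambda>(G, u) (H, w). \<exists>f. bij_betw f (nodes G) (nodes H) \<and>
     (\<forall>x\<in>nodes G. \<forall>y\<in>nodes G. (x, y) \<in> edges G \<longleftrightarrow> (f x, f y) \<in> edges H) \<and>
     (\<forall>x\<in>nodes G. lab H (f x) = lab G x) \<and> f u = w)"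

definition node_query :: "nat \<Rightarrow> 'v pgraph set \<Rightarrow> bool" where
  "node_query n Q \<longleftrightarrow> Q \<subseteq> pointed_graphs n \<and>
     (\<forall>P\<in>Q. \<forall>P'\<in>pointed_graphs n. pgraph_iso P P' \<longrightarrow> P' \<in> Q)"

definition keying :: "'v graph \<Rightarrow> ('v \<Rightarrow> real) \<Rightarrow> bool" where
  "keying G key \<longleftrightarrow> inj_on key (nodes G)"


section \<open>Graph neural networks\<close>

record layer =
  idim :: nat
  odim :: nat
  agg :: "real vec multiset \<Rightarrow> real vec"
  com :: "real vec \<Rightarrow> real vec"

type_synonym gnn = "layer list"

text \<open>The equation between lists says that the input dimension of the first layer is \<open>n + 1\<close>, that
  the output dimension of each layer is the input dimension of the next one, and that the output
  dimension of the last layer is \<open>1\<close>.\<close>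

definition is_gnn :: "nat \<Rightarrow> gnn \<Rightarrow> bool" where
  "is_gnn n Ls \<longleftrightarrow>
     map idim Ls @ [1] = (n + 1) # map odim Ls \<and>
     (\<forall>L\<in>set Ls.
        (\<forall>M. set_mset M \<subseteq> carrier_vec (idim L) \<longrightarrow> agg L M \<in> carrier_vec (idim L)) \<and>
        com L \<in> carrier_vec (2 * idim L) \<rightarrow> carrier_vec (odim L))"

definition init_emb :: "'v graph \<Rightarrow> ('v \<Rightarrow> real) \<Rightarrow> 'v \<Rightarrow> real vec" where
  "init_emb G key v = map_vec of_bool (lab G v) @\<^sub>v vec 1 (\<lambda>_. key v)"

definition layer_emb :: "'v graph \<Rightarrow> layer \<Rightarrow> ('v \<Rightarrow> real vec) \<Rightarrow> 'v \<Rightarrow> real vec" where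
  "layer_emb G L emb u =
     com L (emb u @\<^sub>v agg L (image_mset emb (mset_set {v. (u, v) \<in> edges G})))"

definition gnn_output :: "gnn \<Rightarrow> 'v graph \<Rightarrow> ('v \<Rightarrow> real) \<Rightarrow> 'v \<Rightarrow> real" where
  "gnn_output Ls G key u = fold (layer_emb G) Ls (init_emb G key) u $ 0"

definition gnn_accepts :: "gnn \<Rightarrow> 'v graph \<Rightarrow> ('v \<Rightarrow> real) \<Rightarrow> 'v \<Rightarrow> bool" where
  "gnn_accepts Ls G key u \<longleftrightarrow> gnn_output Ls G key u > 0"

definition local_sum :: "gnn \<Rightarrow> bool" where
  "local_sum Ls \<longleftrightarrow> (\<forall>L\<in>set Ls. \<forall>M. set_mset M \<subseteq> carrier_vec (idim L) \<longrightarrow>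
     agg L M = vec (idim L) (\<lambda>j. \<Sum>x\<in>#M. x $ j))"

definition relu :: "real \<Rightarrow> real" where
  "relu x = max x 0"

inductive relu_ffn :: "nat \<Rightarrow> nat \<Rightarrow> (real vec \<Rightarrow> real vec) \<Rightarrow> bool" where
  affine: "(A :: rat mat) \<in> carrier_mat m k \<Longrightarrow> (b :: rat vec) \<in> carrier_vec m \<Longrightarrow>
     relu_ffn k m (\<lambda>x. map_mat of_rat A *\<^sub>v x + map_vec of_rat b)"
| relu: "relu_ffn m m (map_vec relu)"
| comp: "relu_ffn k m f \<Longrightarrow> relu_ffn m l g \<Longrightarrow> relu_ffn k l (g \<circ> f)"

definition relu_combinations :: "gnn \<Rightarrow> bool" where
  "relu_combinations Ls \<longleftrightarrow> (\<forall>L\<in>set Ls. \<exists>f. relu_ffn (2 * idim L) (odim L) f \<and>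
     (\<forall>x\<in>carrier_vec (2 * idim L). com L x = f x))"

definition key_invariant :: "'v itself \<Rightarrow> nat \<Rightarrow> gnn \<Rightarrow> bool" where
  "key_invariant _ n Ls \<longleftrightarrow> (\<forall>(G :: 'v graph, u) \<in> pointed_graphs n.
     (\<forall>key. keying G key \<longrightarrow> gnn_accepts Ls G key u) \<or>
     (\<forall>key. keying G key \<longrightarrow> \<not> gnn_accepts Ls G key u))"

text \<open>Meant for key-invariant GNNs only.\<close>

definition gnn_expresses :: "nat \<Rightarrow> gnn \<Rightarrow> 'v pgraph set \<Rightarrow> bool" where
  "gnn_expresses n Ls Q \<longleftrightarrow>
     Q = {(G, u) \<in> pointed_graphs n. \<forall>key. keying G key \<longrightarrow> gnn_accepts Ls G key u}"


section \<open>First-order logic with counting\<close>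

text \<open>Variables of both sorts are numbered by natural numbers, in separate name spaces. The
  connectives and the quantifier that are not listed are definable as usual. \<open>Count xs ys \<psi>\<close> is
  the term \<open>#(x\<^sub>1,\<dots>,x\<^sub>k,y\<^sub>1<\<theta>\<^sub>1,\<dots>,y\<^sub>l<\<theta>\<^sub>l).\<psi>\<close>; the variables it binds are bound
  in \<open>\<psi>\<close> only, so the bounds \<open>\<theta>\<^sub>j\<close> are evaluated under the ambient assignment. The type parameter
  is the set of proposition symbols, and \<open>fml_props \<phi>\<close> is the set of those occurring in \<open>\<phi>\<close>.\<close>

datatype (trm_props: 'p) trm =
    NumVar nat
  | Zero
  | One
  | Order
  | Plus "'p trm" "'p trm"
  | Times "'p trm" "'p trm"
  | Count "nat list" "(nat \<times> 'p trm) list" "'p fml"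
and (fml_props: 'p) fml =
    Edge nat nat
  | Less nat nat
  | Equal nat nat
  | Prop 'p nat
  | Leq "'p trm" "'p trm"
  | Neg "'p fml"
  | Conj "'p fml" "'p fml"
  | Exists nat "'p fml"

fun upds :: "(nat \<Rightarrow> 'a) \<Rightarrow> nat list \<Rightarrow> 'a list \<Rightarrow> nat \<Rightarrow> 'a" where
  "upds s (x # xs) (a # as) = upds (s(x := a)) xs as"
| "upds s _ _ = s"

text \<open>\<open>r\<close> interprets the order symbol, \<open>s\<close> and \<open>t\<close> assign values to the node variables and to the
  number variables.\<close>

fun trm_val :: "'v graph \<Rightarrow> ('v \<times> 'v) set \<Rightarrow> (nat \<Rightarrow> 'v) \<Rightarrow> (nat \<Rightarrow> nat) \<Rightarrow> nat trm \<Rightarrow> nat"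
  and fml_sat :: "'v graph \<Rightarrow> ('v \<times> 'v) set \<Rightarrow> (nat \<Rightarrow> 'v) \<Rightarrow> (nat \<Rightarrow> nat) \<Rightarrow> nat fml \<Rightarrow> bool" where
  "trm_val G r s t (NumVar y) = t y"
| "trm_val G r s t Zero = 0"
| "trm_val G r s t One = 1"
| "trm_val G r s t Order = card (nodes G)"
| "trm_val G r s t (Plus \<theta> \<eta>) = trm_val G r s t \<theta> + trm_val G r s t \<eta>"
| "trm_val G r s t (Times \<theta> \<eta>) = trm_val G r s t \<theta> * trm_val G r s t \<eta>"
| "trm_val G r s t (Count xs ys \<psi>) =
     card {(vs, is). length vs = length xs \<and> set vs \<subseteq> nodes G \<and>
       list_all2 (<) is (map (\<lambda>(y, \<theta>). trm_val G r s t \<theta>) ys) \<and>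
       fml_sat G r (upds s xs vs) (upds t (map fst ys) is) \<psi>}"
| "fml_sat G r s t (Edge x y) \<longleftrightarrow> (s x, s y) \<in> edges G"
| "fml_sat G r s t (Less x y) \<longleftrightarrow> (s x, s y) \<in> r"
| "fml_sat G r s t (Equal x y) \<longleftrightarrow> s x = s y"
| "fml_sat G r s t (Prop p x) \<longleftrightarrow> lab G (s x) $ p"
| "fml_sat G r s t (Leq \<theta> \<eta>) \<longleftrightarrow> trm_val G r s t \<theta> \<le> trm_val G r s t \<eta>"
| "fml_sat G r s t (Neg \<phi>) \<longleftrightarrow> \<not> fml_sat G r s t \<phi>"
| "fml_sat G r s t (Conj \<phi> \<psi>) \<longleftrightarrow> fml_sat G r s t \<phi> \<and> fml_sat G r s t \<psi>"
| "fml_sat G r s t (Exists x \<phi>) \<longleftrightarrow> (\<exists>v\<in>nodes G. fml_sat G r (s(x := v)) t \<phi>)"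

fun trm_free_node :: "'p trm \<Rightarrow> nat set" and fml_free_node :: "'p fml \<Rightarrow> nat set" where
  "trm_free_node (NumVar y) = {}"
| "trm_free_node Zero = {}"
| "trm_free_node One = {}"
| "trm_free_node Order = {}"
| "trm_free_node (Plus \<theta> \<eta>) = trm_free_node \<theta> \<union> trm_free_node \<eta>"
| "trm_free_node (Times \<theta> \<eta>) = trm_free_node \<theta> \<union> trm_free_node \<eta>"
| "trm_free_node (Count xs ys \<psi>) =
     (\<Union>(y, \<theta>)\<in>set ys. trm_free_node \<theta>) \<union> (fml_free_node \<psi> - set xs)"
| "fml_free_node (Edge x y) = {x, y}"
| "fml_free_node (Less x y) = {x, y}"
| "fml_free_node (Equal x y) = {x, y}"
| "fml_free_node (Prop p x) = {x}"
| "fml_free_node (Leq \<theta> \<eta>) = trm_free_node \<theta> \<union> trm_free_node \<eta>"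
| "fml_free_node (Neg \<phi>) = fml_free_node \<phi>"
| "fml_free_node (Conj \<phi> \<psi>) = fml_free_node \<phi> \<union> fml_free_node \<psi>"
| "fml_free_node (Exists x \<phi>) = fml_free_node \<phi> - {x}"

fun trm_free_num :: "'p trm \<Rightarrow> nat set" and fml_free_num :: "'p fml \<Rightarrow> nat set" where
  "trm_free_num (NumVar y) = {y}"
| "trm_free_num Zero = {}"
| "trm_free_num One = {}"
| "trm_free_num Order = {}"
| "trm_free_num (Plus \<theta> \<eta>) = trm_free_num \<theta> \<union> trm_free_num \<eta>"
| "trm_free_num (Times \<theta> \<eta>) = trm_free_num \<theta> \<union> trm_free_num \<eta>"
| "trm_free_num (Count xs ys \<psi>) =
     (\<Union>(y, \<theta>)\<in>set ys. trm_free_num \<theta>) \<union> (fml_free_num \<psi> - fst ` set ys)"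
| "fml_free_num (Edge x y) = {}"
| "fml_free_num (Less x y) = {}"
| "fml_free_num (Equal x y) = {}"
| "fml_free_num (Prop p x) = {}"
| "fml_free_num (Leq \<theta> \<eta>) = trm_free_num \<theta> \<union> trm_free_num \<eta>"
| "fml_free_num (Neg \<phi>) = fml_free_num \<phi>"
| "fml_free_num (Conj \<phi> \<psi>) = fml_free_num \<phi> \<union> fml_free_num \<psi>"
| "fml_free_num (Exists x \<phi>) = fml_free_num \<phi>"

definition unary_formula :: "nat \<Rightarrow> nat fml \<Rightarrow> bool" where
  "unary_formula n \<phi> \<longleftrightarrow>
     fml_props \<phi> \<subseteq> {..<n} \<and> (\<exists>x. fml_free_node \<phi> \<subseteq> {x}) \<and> fml_free_num \<phi> = {}"

definition linear_order_of :: "'v graph \<Rightarrow> ('v \<times> 'v) set \<Rightarrow> bool" where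
  "linear_order_of G r \<longleftrightarrow> r \<subseteq> nodes G \<times> nodes G \<and> strict_linear_order_on (nodes G) r"

text \<open>Satisfaction of a formula with at most one free variable at a node: the value of the free
  variable is \<open>u\<close>, and the values assigned to the other variables are irrelevant.\<close>

definition models_at :: "'v graph \<Rightarrow> ('v \<times> 'v) set \<Rightarrow> nat fml \<Rightarrow> 'v \<Rightarrow> bool" where
  "models_at G r \<phi> u \<longleftrightarrow> fml_sat G r (\<lambda>_. u) (\<lambda>_. 0) \<phi>"

definition order_invariant :: "'v itself \<Rightarrow> nat \<Rightarrow> nat fml \<Rightarrow> bool" where
  "order_invariant _ n \<phi> \<longleftrightarrow> (\<forall>(G :: 'v graph, u) \<in> pointed_graphs n.
     \<forall>r r'. linear_order_of G r \<and> linear_order_of G r' \<longrightarrow>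
       (models_at G r \<phi> u \<longleftrightarrow> models_at G r' \<phi> u))"

definition OrdInvFOC :: "nat \<Rightarrow> 'v pgraph set set" where
  "OrdInvFOC n = {Q. \<exists>\<phi>. unary_formula n \<phi> \<and> order_invariant TYPE('v) n \<phi> \<and>
     Q = {(G, u) \<in> pointed_graphs n. \<forall>r. linear_order_of G r \<longrightarrow> models_at G r \<phi> u}}"

end

theory Submission
  imports Defs
begin

text \<open>By key invariance we may use as key of a node its rank in the given linear order. Then every
  coordinate of every intermediate embedding has the form \<open>(P - N) / d\<close>, where the constant
  \<open>d > 0\<close> depends on the network only and \<open>P\<close>, \<open>N\<close> are values of counting terms at the node:
  truncated subtraction \<open>P - N = #(y < P). N \<le> y\<close> handles ReLU, and
  \<open>#(z, y < \<beta>). E(x,z) \<and> y < \<theta>(z)\<close> is the sum of \<open>\<theta>\<close> over the neighbours. As the bound in a counting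
  term may not mention the counted node \<open>z\<close>, a closed term \<open>\<beta>\<close> bounding all values of \<open>\<theta>\<close> is
  carried along. The output is positive iff \<open>\<not> P \<le> N\<close>.\<close>

section \<open>Ranks in a linear order as keys\<close>

definition ordered_graph :: "nat \<Rightarrow> 'v graph \<Rightarrow> ('v \<times> 'v) set \<Rightarrow> bool" where
  "ordered_graph n G r \<longleftrightarrow> is_graph n G \<and> linear_order_of G r"

definition order_rank :: "'v graph \<Rightarrow> ('v \<times> 'v) set \<Rightarrow> 'v \<Rightarrow> nat" where
  "order_rank G r v = card {w \<in> nodes G. (w, v) \<in> r}"

definition neighbours :: "'v graph \<Rightarrow> 'v \<Rightarrow> 'v set" where
  "neighbours G v = {w. (v, w) \<in> edges G}"

lemma neighbours_subset_nodes:
  assumes "ordered_graph n G r"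
  shows "neighbours G v \<subseteq> nodes G"
  using assms by (auto simp: ordered_graph_def is_graph_def neighbours_def)

lemma finite_nodes:
  assumes "ordered_graph n G r"
  shows "finite (nodes G)"
  using assms by (simp add: ordered_graph_def is_graph_def)

lemma finite_neighbours:
  assumes "ordered_graph n G r"
  shows "finite (neighbours G v)"
  using assms finite_nodes neighbours_subset_nodes finite_subset by metis

text \<open>This makes ranks admissible as keys. If \<open>(v, w) \<in> r\<close>, transitivity puts
  every predecessor of \<open>v\<close> among those of \<open>w\<close>, and \<open>v\<close> itself
  is a predecessor of \<open>w\<close> but, by irreflexivity, not of \<open>v\<close>. Hence ranks
  increase strictly along \<open>r\<close>, and totality compares any two distinct nodes.\<close>

lemma order_rank_inj_on:
  assumes "ordered_graph n G r"
  shows "inj_on (order_rank G r) (nodes G)"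
proof -
  have fin: "finite (nodes G)"
    using assms by (rule finite_nodes)
  have lin: "trans r" "irrefl r" "total_on (nodes G) r"
    using assms
    by (auto simp: ordered_graph_def linear_order_of_def strict_linear_order_on_def)
  have less: "order_rank G r v < order_rank G r w"
    if "(v, w) \<in> r" "v \<in> nodes G" for v w
    unfolding order_rank_def using that lin fin
    by (intro psubset_card_mono) (auto dest: transD irreflD)
  show ?thesis
  proof (rule inj_onI, rule ccontr)
    fix v w
    assume "v \<in> nodes G" "w \<in> nodes G" "order_rank G r v = order_rank G r w" "v \<noteq> w"
    then show False
      using lin(3) less[of v w] less[of w v] by (auto simp: total_on_def)
  qed
qed

text \<open>The order on the natural numbers is pulled back along an injection of the finite node
  set. Existence keeps the quantification over all orders in \<open>OrdInvFOC\<close> from being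
  vacuous.\<close>

lemma ex_linear_order_of:
  assumes "is_graph n G"
  shows "\<exists>r. linear_order_of G r"
proof -
  obtain f :: "'a \<Rightarrow> nat" where f: "inj_on f (nodes G)"
    using assms finite_imp_inj_to_nat_seg[of "nodes G"] by (auto simp: is_graph_def)
  let ?r = "{(x, y) \<in> nodes G \<times> nodes G. f x < f y}"
  have "linear_order_of G ?r"
    using f
    by (auto simp: linear_order_of_def strict_linear_order_on_def trans_def irrefl_def
        total_on_def inj_on_eq_iff[OF f] neq_iff[symmetric] not_less_iff_gr_or_eq)
  then show ?thesis ..
qed


section \<open>Definable numerical functions of a node\<close>

definition trm_over :: "nat \<Rightarrow> nat set \<Rightarrow> nat trm \<Rightarrow> bool" where
  "trm_over n X \<theta> \<longleftrightarrow>
     trm_props \<theta> \<subseteq> {..<n} \<and> trm_free_node \<theta> \<subseteq> X \<and> trm_free_num \<theta> = {}"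

text \<open>There is one term per variable name \<open>x\<close>, so that the function can be
  evaluated at a bound variable such as \<open>Suc x\<close> without substitution into terms. The
  value of \<open>\<theta> x\<close> depends on the assignments only through \<open>s x\<close>, and
  that of the closed term \<open>\<beta>\<close> does not depend on them at all.\<close>

definition represents :: "nat \<Rightarrow> (nat \<Rightarrow> nat trm) \<Rightarrow> nat trm \<Rightarrow>
    ('v graph \<Rightarrow> ('v \<times> 'v) set \<Rightarrow> nat) \<Rightarrow> ('v graph \<Rightarrow> ('v \<times> 'v) set \<Rightarrow> 'v \<Rightarrow> nat) \<Rightarrow> bool" where
  "represents n \<theta> \<beta> b f \<longleftrightarrow> (\<forall>x. trm_over n {x} (\<theta> x)) \<and> trm_over n {} \<beta> \<and>
     (\<forall>G r. ordered_graph n G r \<longrightarrow>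
        (\<forall>s t. trm_val G r s t \<beta> = b G r) \<and>
        (\<forall>s t x. s x \<in> nodes G \<longrightarrow> trm_val G r s t (\<theta> x) = f G r (s x)) \<and>
        (\<forall>v\<in>nodes G. f G r v \<le> b G r))"

lemma representsI:
  assumes "\<And>x. trm_over n {x} (\<theta> x)" "trm_over n {} \<beta>"
    and "\<And>G r s t. ordered_graph n G r \<Longrightarrow> trm_val G r s t \<beta> = b G r"
    and "\<And>G r s t x. ordered_graph n G r \<Longrightarrow> s x \<in> nodes G \<Longrightarrow>
      trm_val G r s t (\<theta> x) = f G r (s x)"
    and "\<And>G r v. ordered_graph n G r \<Longrightarrow> v \<in> nodes G \<Longrightarrow> f G r v \<le> b G r"
  shows "represents n \<theta> \<beta> b f"
  unfolding represents_def using assms by simp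

lemma representsD:
  assumes "represents n \<theta> \<beta> b f"
  shows "trm_over n {x} (\<theta> x)" "trm_over n {} \<beta>"
    and "ordered_graph n G r \<Longrightarrow> trm_val G r s t \<beta> = b G r"
    and "ordered_graph n G r \<Longrightarrow> s x \<in> nodes G \<Longrightarrow> trm_val G r s t (\<theta> x) = f G r (s x)"
    and "ordered_graph n G r \<Longrightarrow> v \<in> nodes G \<Longrightarrow> f G r v \<le> b G r"
  using assms unfolding represents_def by blast+

definition nat_definable ::
    "nat \<Rightarrow> ('v graph \<Rightarrow> ('v \<times> 'v) set \<Rightarrow> 'v \<Rightarrow> nat) \<Rightarrow> bool" where
  "nat_definable n f \<longleftrightarrow> (\<exists>\<theta> \<beta> b. represents n \<theta> \<beta> b f)"

lemma nat_definableI: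
  assumes "represents n \<theta> \<beta> b f"
  shows "nat_definable n f"
  using assms by (auto simp: nat_definable_def)

section \<open>Counting terms for functions with natural values\<close>

primrec const_trm :: "nat \<Rightarrow> nat trm" where
  "const_trm 0 = Zero"
| "const_trm (Suc k) = Plus One (const_trm k)"

lemma trm_over_const_trm: "trm_over n X (const_trm k)"
  by (induction k) (auto simp: trm_over_def)

lemma trm_val_const_trm: "trm_val G r s t (const_trm k) = k"
  by (induction k) auto

lemma nat_definable_const: "nat_definable n (\<lambda>_ _ _. k)"
  by (rule nat_definableI[OF representsI, where \<theta> = "\<lambda>_. const_trm k"
        and \<beta> = "const_trm k" and b = "\<lambda>_ _. k"])
    (simp_all add: trm_over_const_trm trm_val_const_trm)

lemma nat_definable_add:
  assumes "nat_definable n f" "nat_definable n g"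
  shows "nat_definable n (\<lambda>G r v. f G r v + g G r v)"
proof -
  obtain \<theta> \<beta> b where "represents n \<theta> \<beta> b f"
    using assms(1) by (auto simp: nat_definable_def)
  note f = representsD[OF this]
  obtain \<eta> \<gamma> c where "represents n \<eta> \<gamma> c g"
    using assms(2) by (auto simp: nat_definable_def)
  note g = representsD[OF this]
  show ?thesis
    by (rule nat_definableI[OF representsI, where \<theta> = "\<lambda>x. Plus (\<theta> x) (\<eta> x)" and \<beta> = "Plus \<beta> \<gamma>"
          and b = "\<lambda>G r. b G r + c G r"])
      (use f g in \<open>auto simp: trm_over_def intro: add_mono\<close>)
qed

lemma nat_definable_mult_const:
  assumes "nat_definable n f"
  shows "nat_definable n (\<lambda>G r v. k * f G r v)"
proof (induction k)
  case 0
  then show ?case using nat_definable_const[of n 0] by simp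
next
  case (Suc k)
  then show ?case using nat_definable_add[OF assms Suc] by simp
qed

text \<open>Binding number variable 0 captures nothing, since \<open>\<eta> x\<close> has the same
  value under every number assignment. No node variable is counted here, so
  \<open>\<theta> x\<close> itself can bound the counted number. Truncated subtraction does not
  exceed its first argument, so \<open>\<beta>\<close> remains an upper bound.\<close>

lemma nat_definable_diff:
  assumes "nat_definable n f" "nat_definable n g"
  shows "nat_definable n (\<lambda>G r v. f G r v - g G r v)"
proof -
  obtain \<theta> \<beta> b where "represents n \<theta> \<beta> b f"
    using assms(1) by (auto simp: nat_definable_def)
  note f = representsD[OF this]
  obtain \<eta> \<gamma> c where "represents n \<eta> \<gamma> c g"
    using assms(2) by (auto simp: nat_definable_def)
  note g = representsD[OF this]
  let ?\<delta> = "\<lambda>x. Count [] [(0, \<theta> x)] (Leq (\<eta> x) (NumVar 0))"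
  have val: "trm_val G r s t (?\<delta> x) = f G r (s x) - g G r (s x)"
    if "ordered_graph n G r" "s x \<in> nodes G" for G r s t x
  proof -
    \<comment> \<open>The counted tuples are written as an injective image of an interval, from
      which the cardinality is read off.\<close>
    have "{(vs, is). length vs = length [] \<and> set vs \<subseteq> nodes G \<and>
        list_all2 (<) is (map (\<lambda>(y, \<theta>). trm_val G r s t \<theta>) [(0, \<theta> x)]) \<and>
        fml_sat G r (upds s [] vs) (upds t (map fst [(0, \<theta> x)]) is) (Leq (\<eta> x) (NumVar 0))}
      = (\<lambda>i. ([], [i])) ` {g G r (s x)..<f G r (s x)}"
      using that by (auto simp: f(4) g(4) list_all2_Cons2)
    then show ?thesis
      by (simp only: trm_val.simps) (simp add: card_image inj_on_def)
  qed
  show ?thesis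
    by (rule nat_definableI[OF representsI, where \<theta> = ?\<delta> and \<beta> = \<beta> and b = b])
      (use f g val in \<open>auto simp: trm_over_def simp del: trm_val.simps
        intro: le_trans[OF diff_le_self]\<close>)
qed

text \<open>A truth value becomes a number by counting a dummy variable below \<open>One\<close>:
  only 0 is available, and it is counted iff the proposition holds.\<close>

lemma nat_definable_prop:
  assumes "j < n"
  shows "nat_definable n (\<lambda>(G :: 'v graph) r v. of_bool (lab G v $ j))"
proof -
  let ?\<delta> = "\<lambda>x. Count [] [(0, One)] (Prop j x)"
  have val: "trm_val G r s t (?\<delta> x) = of_bool (lab G (s x) $ j)" for G :: "'v graph" and r s t x
  proof -
    have "{(vs, is). length vs = length [] \<and> set vs \<subseteq> nodes G \<and>
        list_all2 (<) is (map (\<lambda>(y, \<theta>). trm_val G r s t \<theta>) [(0, One)]) \<and>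
        fml_sat G r (upds s [] vs) (upds t (map fst [(0, One :: nat trm)]) is) (Prop j x)}
      = (if lab G (s x) $ j then {([], [0])} else {})"
      by (auto simp: list_all2_Cons2)
    then show ?thesis
      by (simp only: trm_val.simps) simp
  qed
  show ?thesis
    by (rule nat_definableI[OF representsI, where \<theta> = ?\<delta> and \<beta> = One and b = "\<lambda>_ _. 1"])
      (use assms val in \<open>auto simp: trm_over_def simp del: trm_val.simps(7)\<close>)
qed

text \<open>The name \<open>Suc x\<close> differs from \<open>x\<close>, so binding it leaves the
  value of \<open>x\<close> intact.\<close>

lemma nat_definable_order_rank: "nat_definable n (order_rank :: 'v graph \<Rightarrow> _)"
proof -
  let ?\<delta> = "\<lambda>x. Count [Suc x] [] (Less (Suc x) x)"
  have val: "trm_val G r s t (?\<delta> x) = order_rank G r (s x)" for G :: "'v graph" and r s t x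
  proof -
    have "{(vs, is). length vs = length [Suc x] \<and> set vs \<subseteq> nodes G \<and>
        list_all2 (<) is (map (\<lambda>(y, \<theta>). trm_val G r s t \<theta>) []) \<and>
        fml_sat G r (upds s [Suc x] vs) (upds t (map fst ([] :: (nat \<times> nat trm) list)) is)
          (Less (Suc x) x)}
      = (\<lambda>w. ([w], [])) ` {w \<in> nodes G. (w, s x) \<in> r}"
      by (auto simp: length_Suc_conv)
    then show ?thesis
      by (simp only: trm_val.simps) (simp add: order_rank_def card_image inj_on_def)
  qed
  show ?thesis
    by (rule nat_definableI[OF representsI, where \<theta> = ?\<delta> and \<beta> = Order
          and b = "\<lambda>G _. card (nodes G)"])
      (use val in \<open>auto simp: trm_over_def order_rank_def simp del: trm_val.simps(7)
        intro!: card_mono finite_nodes\<close>)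
qed

text \<open>The sum is the size of the disjoint union, over the neighbours \<open>w\<close>, of the
  sets of numbers below \<open>f G r w\<close>. A node has at most \<open>card (nodes G)\<close>
  neighbours, which gives the new closed bound \<open>Times Order \<beta>\<close>.\<close>

lemma nat_definable_sum_neighbours:
  assumes "nat_definable n f"
  shows "nat_definable n (\<lambda>G r v. \<Sum>w\<in>neighbours G v. f G r w)"
proof -
  obtain \<theta> \<beta> b where "represents n \<theta> \<beta> b f"
    using assms(1) by (auto simp: nat_definable_def)
  note f = representsD[OF this]
  \<comment> \<open>The negated \<open>Leq\<close> says that the counted number is strictly below
    \<open>\<theta> (Suc x)\<close>.\<close>
  let ?\<psi> = "\<lambda>x. Conj (Edge x (Suc x)) (Neg (Leq (\<theta> (Suc x)) (NumVar 0)))"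
  let ?\<delta> = "\<lambda>x. Count [Suc x] [(0, \<beta>)] (?\<psi> x)"
  have val: "trm_val G r s t (?\<delta> x) = (\<Sum>w\<in>neighbours G (s x). f G r w)"
    if og: "ordered_graph n G r" for G r s t x
  proof -
    have "{(vs, is). length vs = length [Suc x] \<and> set vs \<subseteq> nodes G \<and>
        list_all2 (<) is (map (\<lambda>(y, \<theta>). trm_val G r s t \<theta>) [(0, \<beta>)]) \<and>
        fml_sat G r (upds s [Suc x] vs) (upds t (map fst [(0, \<beta>)]) is) (?\<psi> x)}
      = (\<lambda>(w, i). ([w], [i])) ` (SIGMA w : neighbours G (s x). {..<f G r w})" (is "?A = ?B")
    proof
      show "?A \<subseteq> ?B"
        using og neighbours_subset_nodes[OF og, of "s x"]
        by (auto simp: length_Suc_conv list_all2_Cons2 neighbours_def f(4) not_le image_iff)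
      show "?B \<subseteq> ?A"
      proof clarify
        fix w i
        assume w: "w \<in> neighbours G (s x)" and i: "i < f G r w"
        have w_node: "w \<in> nodes G"
          using w neighbours_subset_nodes[OF og] by blast
        \<comment> \<open>The common bound \<open>\<beta>\<close> cuts off no pair, because it
          dominates the value at every node.\<close>
        have "i < b G r"
          using i f(5)[OF og w_node] by (rule less_le_trans)
        then show "length [w] = length [Suc x] \<and> set [w] \<subseteq> nodes G \<and>
            list_all2 (<) [i] (map (\<lambda>(y, \<theta>). trm_val G r s t \<theta>) [(0, \<beta>)]) \<and>
            fml_sat G r (upds s [Suc x] [w]) (upds t (map fst [(0, \<beta>)]) [i]) (?\<psi> x)"
          using w i w_node og by (simp add: neighbours_def f(3) f(4) not_le)
      qed
    qed
    moreover have "inj_on (\<lambda>(w, i). ([w], [i])) (SIGMA w : neighbours G (s x). {..<f G r w})"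
      by (auto simp: inj_on_def)
    ultimately show ?thesis
      by (simp only: trm_val.simps) (simp add: card_image finite_neighbours[OF og])
  qed
  have bound: "(\<Sum>w\<in>neighbours G v. f G r w) \<le> card (nodes G) * b G r"
    if og: "ordered_graph n G r" for G r v
  proof -
    have "(\<Sum>w\<in>neighbours G v. f G r w) \<le> (\<Sum>w\<in>nodes G. f G r w)"
      using og by (intro sum_mono2 finite_nodes neighbours_subset_nodes) auto
    also have "\<dots> \<le> card (nodes G) * b G r"
      using sum_bounded_above[of "nodes G" "f G r" "b G r"] f(5)[OF og] by simp
    finally show ?thesis .
  qed
  show ?thesis
  proof (rule nat_definableI[OF representsI, where \<theta> = ?\<delta> and \<beta> = "Times Order \<beta>"
        and b = "\<lambda>G r. card (nodes G) * b G r"])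
    show "trm_over n {x} (?\<delta> x)" for x
      using f(1)[of "Suc x"] f(2) by (auto simp: trm_over_def)
    show "trm_over n {} (Times Order \<beta>)"
      using f(2) by (auto simp: trm_over_def)
  qed (use val bound f(3) in \<open>auto simp del: trm_val.simps(7)\<close>)
qed

section \<open>Real-valued functions with a constant denominator\<close>

definition quotient_form :: "('v graph \<Rightarrow> ('v \<times> 'v) set \<Rightarrow> 'v \<Rightarrow> nat) \<Rightarrow>
    ('v graph \<Rightarrow> ('v \<times> 'v) set \<Rightarrow> 'v \<Rightarrow> nat) \<Rightarrow> nat \<Rightarrow>
    nat \<Rightarrow> ('v graph \<Rightarrow> ('v \<times> 'v) set \<Rightarrow> 'v \<Rightarrow> real) \<Rightarrow> bool" where
  "quotient_form p q d n g \<longleftrightarrow> nat_definable n p \<and> nat_definable n q \<and> d > 0 \<and>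
     (\<forall>G r. ordered_graph n G r \<longrightarrow>
        (\<forall>v\<in>nodes G. g G r v = (real (p G r v) - real (q G r v)) / real d))"

text \<open>Terms denote natural numbers only, so signs are encoded as differences and the
  denominator stays outside the logic. All of \<open>p\<close>, \<open>q\<close> and
  \<open>d\<close> are chosen before the graph and the node. In particular, summing over neighbours
  leaves the denominator unchanged.\<close>

definition real_definable ::
    "nat \<Rightarrow> ('v graph \<Rightarrow> ('v \<times> 'v) set \<Rightarrow> 'v \<Rightarrow> real) \<Rightarrow> bool" where
  "real_definable n g \<longleftrightarrow> (\<exists>p q d. quotient_form p q d n g)"

lemma quotient_formD:
  assumes "quotient_form p q d n g"
  shows "nat_definable n p" "nat_definable n q" "d > 0"
    and "ordered_graph n G r \<Longrightarrow> v \<in> nodes G \<Longrightarrow>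
      g G r v = (real (p G r v) - real (q G r v)) / real d"
  using assms by (auto simp: quotient_form_def)

lemma real_definableI:
  assumes "nat_definable n p" "nat_definable n q" "d > 0"
    and "\<And>G r v. ordered_graph n G r \<Longrightarrow> v \<in> nodes G \<Longrightarrow>
      g G r v = (real (p G r v) - real (q G r v)) / real d"
  shows "real_definable n g"
  unfolding real_definable_def quotient_form_def using assms by blast

text \<open>Agreement at nodes of ordered graphs suffices. Coordinates of vectors can thus be
  rewritten where their dimensions are known.\<close>

lemma real_definable_cong:
  assumes "real_definable n g"
    and "\<And>G r v. ordered_graph n G r \<Longrightarrow> v \<in> nodes G \<Longrightarrow> h G r v = g G r v"
  shows "real_definable n h"
  using assms unfolding real_definable_def quotient_form_def by metis

lemma real_definable_of_nat:
  assumes "nat_definable n f"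
  shows "real_definable n (\<lambda>G r v. real (f G r v))"
  by (rule real_definableI[OF assms nat_definable_const[of n 0], of 1]) auto

text \<open>Cross-multiplication to the denominator \<open>d * d'\<close> only needs multiples by
  the constants \<open>d\<close> and \<open>d'\<close>.\<close>

lemma real_definable_add:
  assumes "real_definable n f" "real_definable n g"
  shows "real_definable n (\<lambda>G r v. f G r v + g G r v)"
proof -
  obtain p q d where "quotient_form p q d n f"
    using assms(1) by (auto simp: real_definable_def)
  note f = quotient_formD[OF this]
  obtain p' q' d' where "quotient_form p' q' d' n g"
    using assms(2) by (auto simp: real_definable_def)
  note g = quotient_formD[OF this]
  show ?thesis
    by (rule real_definableI[where d = "d * d'",
          OF nat_definable_add[OF nat_definable_mult_const[OF f(1), of d']
              nat_definable_mult_const[OF g(1), of d]]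
            nat_definable_add[OF nat_definable_mult_const[OF f(2), of d']
              nat_definable_mult_const[OF g(2), of d]]])
      (use f(3) g(3) in \<open>auto simp: f(4) g(4) field_simps\<close>)
qed

text \<open>This is where rationality of the weights enters: for \<open>c = a / e\<close> the
  denominator \<open>e\<close> is absorbed into \<open>d\<close>. With \<open>a\<close> split into
  its positive part \<open>a1\<close> and negative part \<open>a2\<close>, the numerator is
  \<open>(a1 * p + a2 * q) - (a1 * q + a2 * p)\<close>.\<close>

lemma real_definable_mult_rat:
  assumes "real_definable n f"
  shows "real_definable n (\<lambda>G r v. of_rat c * f G r v)"
proof -
  obtain p q d where "quotient_form p q d n f"
    using assms(1) by (auto simp: real_definable_def)
  note f = quotient_formD[OF this]
  obtain a e where ae: "quotient_of c = (a, e)"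
    by fastforce
  have e: "e > 0"
    using quotient_of_denom_pos[OF ae] .
  have c: "of_rat c = real_of_int a / real_of_int e"
    using quotient_of_div[OF ae] by (simp add: of_rat_divide)
  \<comment> \<open>As \<open>nat\<close> sends negative integers to 0, at most one of the two parts
    is nonzero.\<close>
  have a: "real_of_int a = real (nat a) - real (nat (- a))"
    by (cases "a \<ge> 0") auto
  show ?thesis
    by (rule real_definableI[where d = "nat e * d",
          OF nat_definable_add[OF nat_definable_mult_const[OF f(1), of "nat a"]
              nat_definable_mult_const[OF f(2), of "nat (- a)"]]
            nat_definable_add[OF nat_definable_mult_const[OF f(2), of "nat a"]
              nat_definable_mult_const[OF f(1), of "nat (- a)"]]])
      (use f(3) e in \<open>auto simp: f(4) c a algebra_simps\<close>)
qed

lemma real_definable_rat: "real_definable n (\<lambda>_ _ _. of_rat c)"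
  using real_definable_mult_rat[OF real_definable_of_nat[OF nat_definable_const[of n 1]], of c]
  by simp

lemma real_definable_sum:
  assumes "\<And>i. i \<in> I \<Longrightarrow> real_definable n (f i)"
  shows "real_definable n (\<lambda>G r v. \<Sum>i\<in>I. f i G r v)"
  using assms
proof (induction I rule: infinite_finite_induct)
  case (insert i I)
  then show ?case
    using real_definable_add[of n "f i"] by simp
\<comment> \<open>Sums over the empty set and over infinite sets are 0, which is a definable
  constant.\<close>
qed (use real_definable_rat[of n 0] in simp_all)

lemma real_definable_relu:
  assumes "real_definable n f"
  shows "real_definable n (\<lambda>G r v. relu (f G r v))"
proof -
  obtain p q d where "quotient_form p q d n f"
    using assms(1) by (auto simp: real_definable_def)
  note f = quotient_formD[OF this]
  \<comment> \<open>Since \<open>d > 0\<close>, ReLU acts on the numerator, where it is truncated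
    subtraction; the new negative part is 0.\<close>
  have "relu ((real a - real b) / real d) = (real (a - b) - real 0) / real d" for a b
    using f(3) by (auto simp: relu_def max_def of_nat_diff field_simps)
  then show ?thesis
    by (intro real_definableI[OF nat_definable_diff[OF f(1,2)] nat_definable_const[of n 0] f(3)])
      (simp add: f(4))
qed

lemma real_definable_sum_neighbours:
  assumes "real_definable n f"
  shows "real_definable n (\<lambda>G r v. \<Sum>w\<in>neighbours G v. f G r w)"
proof -
  obtain p q d where "quotient_form p q d n f"
    using assms(1) by (auto simp: real_definable_def)
  note f = quotient_formD[OF this]
  show ?thesis
  proof (rule real_definableI[OF nat_definable_sum_neighbours[OF f(1)]
        nat_definable_sum_neighbours[OF f(2)] f(3)])
    fix G :: "'a graph" and r v
    assume og: "ordered_graph n G r"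
    have "(\<Sum>w\<in>neighbours G v. f G r w)
        = (\<Sum>w\<in>neighbours G v. (real (p G r w) - real (q G r w)) / real d)"
      using f(4)[OF og] neighbours_subset_nodes[OF og] by (intro sum.cong) auto
    then show "(\<Sum>w\<in>neighbours G v. f G r w)
        = (real (\<Sum>w\<in>neighbours G v. p G r w) - real (\<Sum>w\<in>neighbours G v. q G r w)) / real d"
      by (simp add: sum_divide_distrib[symmetric] sum_subtractf)
  qed
qed


section \<open>Definability of the embeddings\<close>

definition vec_definable ::
    "nat \<Rightarrow> nat \<Rightarrow> ('v graph \<Rightarrow> ('v \<times> 'v) set \<Rightarrow> 'v \<Rightarrow> real vec) \<Rightarrow> bool" where
  "vec_definable n k F \<longleftrightarrow>
     (\<forall>G r. ordered_graph n G r \<longrightarrow> (\<forall>v\<in>nodes G. F G r v \<in> carrier_vec k)) \<and>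
     (\<forall>j<k. real_definable n (\<lambda>G r v. F G r v $ j))"

lemma vec_definableI:
  assumes "\<And>G r v. ordered_graph n G r \<Longrightarrow> v \<in> nodes G \<Longrightarrow> F G r v \<in> carrier_vec k"
    and "\<And>j. j < k \<Longrightarrow> real_definable n (\<lambda>G r v. F G r v $ j)"
  shows "vec_definable n k F"
  using assms by (simp add: vec_definable_def)

lemma vec_definable_carrier:
  assumes "vec_definable n k F" "ordered_graph n G r" "v \<in> nodes G"
  shows "F G r v \<in> carrier_vec k"
  using assms by (simp add: vec_definable_def)

lemma vec_definable_index:
  assumes "vec_definable n k F" "j < k"
  shows "real_definable n (\<lambda>G r v. F G r v $ j)"
  using assms by (simp add: vec_definable_def)

lemma vec_definable_cong:
  assumes "vec_definable n k F"
    and "\<And>G r v. ordered_graph n G r \<Longrightarrow> v \<in> nodes G \<Longrightarrow> H G r v = F G r v"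
  shows "vec_definable n k H"
proof (rule vec_definableI)
  show "H G r v \<in> carrier_vec k" if "ordered_graph n G r" "v \<in> nodes G" for G r v
    using vec_definable_carrier[OF assms(1) that] assms(2)[OF that] by simp
  show "real_definable n (\<lambda>G r v. H G r v $ j)" if "j < k" for j
    using vec_definable_index[OF assms(1) that] by (rule real_definable_cong) (simp add: assms(2))
qed

text \<open>Induction on the network with \<open>F\<close> arbitrary, so that in a composition the
  outer network can be applied to the output of the inner one. Each coordinate of an affine map is a
  finite sum of rational multiples of coordinates plus a rational constant.\<close>

lemma vec_definable_relu_ffn:
  assumes "relu_ffn k m f" "vec_definable n k F"
  shows "vec_definable n m (\<lambda>G r v. f (F G r v))"
  using assms
proof (induction arbitrary: F rule: relu_ffn.induct)
  case (affine A m k b)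
  note carrier = vec_definable_carrier[OF affine.prems]
  show ?case
  proof (rule vec_definableI)
    fix j
    assume j: "j < m"
    have "real_definable n (\<lambda>G r v. (\<Sum>i<k. of_rat (A $$ (j, i)) * F G r v $ i) + of_rat (b $ j))"
      by (intro real_definable_add real_definable_sum real_definable_mult_rat real_definable_rat
          vec_definable_index[OF affine.prems]) simp
    then show "real_definable n
        (\<lambda>G r v. (map_mat of_rat A *\<^sub>v F G r v + map_vec of_rat b) $ j)"
    proof (rule real_definable_cong)
      fix G :: "'a graph" and r v
      assume "ordered_graph n G r" "v \<in> nodes G"
      then have "F G r v \<in> carrier_vec k"
        by (rule carrier)
      then show "(map_mat of_rat A *\<^sub>v F G r v + map_vec of_rat b) $ j
          = (\<Sum>i<k. of_rat (A $$ (j, i)) * F G r v $ i) + of_rat (b $ j)"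
        using j affine.hyps by (simp add: scalar_prod_def lessThan_atLeast0)
    qed
  qed (use affine.hyps in \<open>auto intro!: add_carrier_vec mult_mat_vec_carrier carrier\<close>)
next
  case (relu m)
  note carrier = vec_definable_carrier[OF relu.prems]
  show ?case
  proof (rule vec_definableI)
    show "real_definable n (\<lambda>G r v. map_vec relu (F G r v) $ j)" if "j < m" for j
      using real_definable_relu[OF vec_definable_index[OF relu.prems that]]
      by (rule real_definable_cong) (use carrier that in \<open>metis carrier_vecD index_map_vec(1)\<close>)
  qed (use carrier in auto)
next
  case (comp k m f l g)
  show ?case
    using comp.IH(2)[OF comp.IH(1)[OF comp.prems]] by simp
qed

lemma vec_definable_append:
  assumes "vec_definable n k F" "vec_definable n m H"
  shows "vec_definable n (k + m) (\<lambda>G r v. F G r v @\<^sub>v H G r v)"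
proof (rule vec_definableI)
  show "F G r v @\<^sub>v H G r v \<in> carrier_vec (k + m)"
    if "ordered_graph n G r" "v \<in> nodes G" for G r v
    using assms[THEN vec_definable_carrier, OF that] by simp
  fix j
  assume j: "j < k + m"
  have eq: "(F G r v @\<^sub>v H G r v) $ j = (if j < k then F G r v $ j else H G r v $ (j - k))"
    if "ordered_graph n G r" "v \<in> nodes G" for G r v
    using assms[THEN vec_definable_carrier, OF that] j by auto
  show "real_definable n (\<lambda>G r v. (F G r v @\<^sub>v H G r v) $ j)"
  proof (cases "j < k")
    case True
    show ?thesis
      using vec_definable_index[OF assms(1) True] by (rule real_definable_cong) (simp add: eq True)
  next
    case False
    then have "j - k < m"
      using j by simp
    show ?thesis
      using vec_definable_index[OF assms(2) \<open>j - k < m\<close>]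
      by (rule real_definable_cong) (simp add: eq False)
  qed
qed

lemma vec_definable_init_emb:
  "vec_definable n (n + 1) (\<lambda>G r. init_emb G (\<lambda>v. real (order_rank G r v)))"
  unfolding init_emb_def
proof (rule vec_definable_append; rule vec_definableI)
  have lab: "lab G v \<in> carrier_vec n" if "ordered_graph n G r" "v \<in> nodes G"
    for G :: "'a graph" and r v
    using that by (simp add: ordered_graph_def is_graph_def)
  show "map_vec of_bool (lab G v) \<in> carrier_vec n" if "ordered_graph n G r" "v \<in> nodes G"
    for G :: "'a graph" and r v
    using lab[OF that] by simp
  show "real_definable n (\<lambda>(G :: 'a graph) r v. map_vec of_bool (lab G v) $ j)" if "j < n" for j
  proof (rule real_definable_cong[OF real_definable_of_nat[OF nat_definable_prop[OF that]]])
    fix G :: "'a graph" and r v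
    assume "ordered_graph n G r" "v \<in> nodes G"
    from lab[OF this] show "map_vec of_bool (lab G v) $ j = real (of_bool (lab G v $ j))"
      using that by simp
  qed
  show "real_definable n (\<lambda>(G :: 'a graph) r v. vec 1 (\<lambda>_. real (order_rank G r v)) $ j)"
    if "j < 1" for j
    using that real_definable_of_nat[OF nat_definable_order_rank] by simp
qed simp

lemma vec_definable_layer_emb:
  assumes F: "vec_definable n (idim L) F"
    and agg: "\<And>M. set_mset M \<subseteq> carrier_vec (idim L) \<Longrightarrow>
      agg L M = vec (idim L) (\<lambda>j. \<Sum>x\<in>#M. x $ j)"
    and f: "relu_ffn (2 * idim L) (odim L) f"
    and com: "\<And>x. x \<in> carrier_vec (2 * idim L) \<Longrightarrow> com L x = f x"
  shows "vec_definable n (odim L) (\<lambda>G r. layer_emb G L (F G r))"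
proof -
  let ?S = "\<lambda>G r v. vec (idim L) (\<lambda>j. \<Sum>w\<in>neighbours G v. F G r w $ j)"
  have "vec_definable n (idim L) ?S"
  proof (rule vec_definableI)
    show "real_definable n (\<lambda>G r v. ?S G r v $ j)" if "j < idim L" for j
      using real_definable_sum_neighbours[OF vec_definable_index[OF F that]] that by simp
  qed simp
  with F have FS: "vec_definable n (2 * idim L) (\<lambda>G r v. F G r v @\<^sub>v ?S G r v)"
    unfolding mult_2 by (rule vec_definable_append)
  have "layer_emb G L (F G r) v = f (F G r v @\<^sub>v ?S G r v)"
    if og: "ordered_graph n G r" and v: "v \<in> nodes G" for G r v
  proof -
    let ?M = "image_mset (F G r) (mset_set (neighbours G v))"
    \<comment> \<open>The aggregation is known only on multisets of vectors of dimension
      \<open>idim L\<close>; neighbours are nodes, where \<open>F\<close> has that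
      dimension.\<close>
    have "set_mset ?M \<subseteq> carrier_vec (idim L)"
      using vec_definable_carrier[OF F og] neighbours_subset_nodes[OF og]
      by (auto simp: finite_neighbours[OF og])
    then have "agg L ?M = vec (idim L) (\<lambda>j. \<Sum>x\<in>#?M. x $ j)"
      by (rule agg)
    also have "\<dots> = ?S G r v"
      by (simp add: sum_unfold_sum_mset multiset.map_comp comp_def)
    finally show ?thesis
      using com[OF vec_definable_carrier[OF FS og v]] by (simp add: layer_emb_def neighbours_def)
  qed
  then show ?thesis
    using vec_definable_relu_ffn[OF f FS] by (rule vec_definable_cong[rotated])
qed

text \<open>The dimension equation of \<open>is_gnn\<close> is stated for an arbitrary input
  dimension \<open>k\<close>: after the first layer is removed, its output dimension takes over the
  role of \<open>k\<close>. For the empty list the equation forces \<open>m = k\<close>.\<close>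

lemma vec_definable_fold_layer_emb:
  assumes "vec_definable n k F" "map idim Ls @ [m] = k # map odim Ls"
    and "local_sum Ls" "relu_combinations Ls"
  shows "vec_definable n m (\<lambda>G r. fold (layer_emb G) Ls (F G r))"
  using assms
proof (induction Ls arbitrary: k F)
  case Nil
  then show ?case by simp
next
  case (Cons L Ls)
  have k: "k = idim L" and dims: "map idim Ls @ [m] = odim L # map odim Ls"
    using Cons.prems(2) by auto
  obtain f where f: "relu_ffn (2 * idim L) (odim L) f"
    "\<And>x. x \<in> carrier_vec (2 * idim L) \<Longrightarrow> com L x = f x"
    using Cons.prems(4) by (auto simp: relu_combinations_def)
  have "vec_definable n (odim L) (\<lambda>G r. layer_emb G L (F G r))"
    using Cons.prems(1,3) f by (intro vec_definable_layer_emb) (auto simp: k local_sum_def)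
  from Cons.IH[OF this dims] show ?case
    using Cons.prems(3,4) by (simp add: local_sum_def relu_combinations_def)
qed

section \<open>From a positive output to a formula\<close>

lemma real_definable_positive_formula:
  fixes g :: "'v graph \<Rightarrow> ('v \<times> 'v) set \<Rightarrow> 'v \<Rightarrow> real"
  assumes "real_definable n g"
  obtains \<phi> where "unary_formula n \<phi>"
    and "\<And>G r u. ordered_graph n G r \<Longrightarrow> u \<in> nodes G \<Longrightarrow> models_at G r \<phi> u \<longleftrightarrow> g G r u > 0"
proof -
  obtain p q d where "quotient_form p q d n g"
    using assms(1) by (auto simp: real_definable_def)
  note g = quotient_formD[OF this]
  obtain \<theta> \<gamma> c where "represents n \<theta> \<gamma> c p"
    using g(1) by (auto simp: nat_definable_def)
  note p = representsD[OF this]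
  obtain \<eta> \<gamma> c where "represents n \<eta> \<gamma> c q"
    using g(2) by (auto simp: nat_definable_def)
  note q = representsD[OF this]
  \<comment> \<open>Since \<open>d > 0\<close>, positivity of the quotient means that
    \<open>p\<close> exceeds \<open>q\<close>. Variable 0 can be the free one because
    \<open>models_at\<close> assigns \<open>u\<close> to every node variable.\<close>
  let ?\<phi> = "Neg (Leq (\<theta> 0) (\<eta> 0))"
  show thesis
  proof (rule that)
    show "unary_formula n ?\<phi>"
      using p(1)[of 0] q(1)[of 0] by (auto simp: unary_formula_def trm_over_def)
    show "models_at G r ?\<phi> u \<longleftrightarrow> g G r u > 0" if "ordered_graph n G r" "u \<in> nodes G" for G r u
      using that g(3) by (simp add: models_at_def p(4) q(4) g(4) not_le zero_less_divide_iff)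
  qed
qed

theorem theorem5p9:
  fixes n :: nat and Ls :: gnn and Q :: "'v::infinite pgraph set"
  assumes "node_query n Q"
    and "is_gnn n Ls"
    and "local_sum Ls"
    and "relu_combinations Ls"
    and "key_invariant TYPE('v) n Ls"
    and "gnn_expresses n Ls Q"
  shows "Q \<in> OrdInvFOC n"
proof -
  let ?key = "\<lambda>(G :: 'v graph) r v. real (order_rank G r v)"
  have "vec_definable n 1 (\<lambda>(G :: 'v graph) r. fold (layer_emb G) Ls (init_emb G (?key G r)))"
    using vec_definable_init_emb assms(2-4)
    by (intro vec_definable_fold_layer_emb) (auto simp: is_gnn_def)
  then have "real_definable n (\<lambda>(G :: 'v graph) r. gnn_output Ls G (?key G r))"
    unfolding gnn_output_def by (rule vec_definable_index) simp
  then obtain \<phi> where \<phi>: "unary_formula n \<phi>"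
    and models: "\<And>(G :: 'v graph) r u. ordered_graph n G r \<Longrightarrow> u \<in> nodes G \<Longrightarrow>
      models_at G r \<phi> u \<longleftrightarrow> gnn_accepts Ls G (?key G r) u"
    unfolding gnn_accepts_def by (rule real_definable_positive_formula) blast
  \<comment> \<open>The right-hand side does not mention \<open>r\<close>, so this yields both order
    invariance and the description of \<open>Q\<close>.\<close>
  have iff: "models_at G r \<phi> u \<longleftrightarrow> (G, u) \<in> Q"
    if G: "(G, u) \<in> pointed_graphs n" and r: "linear_order_of G r" for G u r
  proof -
    have og: "ordered_graph n G r" and u: "u \<in> nodes G"
      using G r by (auto simp: pointed_graphs_def ordered_graph_def)
    have "keying G (?key G r)"
      using order_rank_inj_on[OF og] by (auto simp: keying_def inj_on_def)
    \<comment> \<open>Key invariance carries acceptance under the rank key over to all keys.\<close>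
    then have "gnn_accepts Ls G (?key G r) u \<longleftrightarrow> (\<forall>key. keying G key \<longrightarrow> gnn_accepts Ls G key u)"
      using assms(5) G unfolding key_invariant_def by blast
    then show ?thesis
      using models[OF og u] assms(6) G by (simp add: gnn_expresses_def)
  qed
  have "order_invariant TYPE('v) n \<phi>"
    unfolding order_invariant_def using iff by blast
  moreover have "Q = {(G, u) \<in> pointed_graphs n. \<forall>r. linear_order_of G r \<longrightarrow> models_at G r \<phi> u}"
  proof -
    \<comment> \<open>Some order must exist for satisfaction under all orders to imply membership in
      \<open>Q\<close>.\<close>
    have "\<exists>r. linear_order_of G r" if "(G, u) \<in> pointed_graphs n" for G :: "'v graph" and u
      using that ex_linear_order_of by (auto simp: pointed_graphs_def)
    moreover have "Q \<subseteq> pointed_graphs n"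
      using assms(6) by (auto simp: gnn_expresses_def)
    ultimately show ?thesis
      using iff by blast
  qed
  ultimately show ?thesis
    using \<phi> unfolding OrdInvFOC_def by blast
qed

end
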